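(* Let $N=\mathbb{Z}^4$ and let $a,r$ be integers with $\gcd(a,r)=1$, $1<a<r-a<r$ and $2\nmid r$. Let $X_\sigma$ be the four-dimensional Gorenstein terminal $\mathbb{Q}$-factorial affine toric variety associated to the cone $\sigma\subseteq N_{\mathbb{R}}=\mathbb{R}^4$ generated by $$e_1=(1,0,0,0),\quad e_2=(0,1,0,0),\quad e_3=(0,0,1,0),\quad e_4=(1,a,r-a,r).$$ Then $X_\sigma$ does not admit a Hilbert basis resolution; that is, there is no Hilbert basis resolution $\Sigma$ of $\sigma$.
   Context: Let $M$ and $N$ be free abelian groups of rank $d$ dual to each other, $N_{\mathbb{R}}=N\otimes\mathbb{R}$, $M_{\mathbb{R}}=M\otimes\mathbb{R}$, and $k$ an arbitrary field. A cone in $N_{\mathbb{R}}$ means a strongly convex, rational polyhedral cone. For a cone $\sigma$ with dual cone $\sigma^\vee\subseteq M_{\mathbb{R}}$, $X_\sigma=\operatorname{Spec} k[\sigma^\vee\cap M]$; for a fan $\Sigma$, $X_\Sigma$ is the associated toric variety. Each one-dimensional cone $\rho$ contains a unique primitive element $P(\rho)\in\rho\cap N$; $\operatorname{Gen}(\tau)$ denotes the set of the $P(\rho)$ for $\rho$ the one-dimensional faces of a cone $\tau$, and $\operatorname{Gen}(\Sigma)=\bigcup_{\tau\in\Sigma}\operatorname{Gen}(\tau)$ for a fan $\Sigma$. A cone is smooth if its minimal generators $\operatorname{Gen}$ form part of a $\mathbb{Z}$-basis of $N$; a fan is smooth if all of its cones are smooth. A subdivision of $\sigma$ is a (finite) fan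 whose support is $\sigma$. The Hilbert basis of $\sigma$ is $$\operatorname{Hilb}_N(\sigma)=\{n\in\sigma\cap N\setminus\{0\}\mid \forall n_1,n_2\in\sigma\cap N,\ n=n_1+n_2\Rightarrow n_1=0\text{ or }n_2=0\}.$$ A subdivision $\Sigma$ of a cone $\sigma$ is a Hilbert basis resolution if $\Sigma$ is smooth and $\operatorname{Gen}(\Sigma)=\operatorname{Hilb}_N(\sigma)$; the induced morphism $X_\Sigma\to X_\sigma$ is also called a Hilbert basis resolution. *)

theory Defs
  imports "HOL-Analysis.Analysis"
begin

text \<open>
  The lattice \<open>N\<close> is the set of integer vectors inside \<open>N\<^sub>\<real> =\<close> \<^typ>\<open>real^'n\<close>. Its
  \<open>\<int>\<close>-module structure is obtained from the library locale of modules by restricting scalars.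
\<close>

definition int_lattice :: "(real^'n) set" where
  "int_lattice = {x. \<forall>i. x $ i \<in> \<int>}"

global_interpretation zmod: module "\<lambda>(k::int) (x::real^'n). of_int k *\<^sub>R x"
  by unfold_locales (simp_all add: algebra_simps)

definition lattice_basis :: "(real^'n) set \<Rightarrow> bool" where
  "lattice_basis B \<longleftrightarrow> zmod.independent B \<and> zmod.span B = int_lattice"

definition toric_cone :: "(real^'n) set \<Rightarrow> bool" where
  "toric_cone \<sigma> \<longleftrightarrow>
     (\<exists>S. finite S \<and> S \<subseteq> int_lattice \<and> \<sigma> = convex_cone hull S) \<and>
     (\<forall>x. x \<in> \<sigma> \<and> - x \<in> \<sigma> \<longrightarrow> x = 0)"

text \<open>
  The library relation \<open>face_of\<close> also admits the empty set, which is not a face of a cone;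
  see \<open>cone_face_iff_supporting\<close> for the description by supporting hyperplanes.
\<close>

definition cone_face :: "(real^'n) set \<Rightarrow> (real^'n) set \<Rightarrow> bool" where
  "cone_face \<tau> \<sigma> \<longleftrightarrow> \<tau> face_of \<sigma> \<and> \<tau> \<noteq> {}"

definition primitive :: "real^'n \<Rightarrow> bool" where
  "primitive n \<longleftrightarrow> n \<in> int_lattice \<and> n \<noteq> 0 \<and>
     (\<forall>k::nat. \<forall>m\<in>int_lattice. n = of_nat k *\<^sub>R m \<longrightarrow> k = 1)"

text \<open>Well defined on one-dimensional cones by \<open>ex1_primitive\<close>.\<close>

definition ray_generator :: "(real^'n) set \<Rightarrow> real^'n" where
  "ray_generator \<rho> = (THE n. n \<in> \<rho> \<and> primitive n)"

definition Gen :: "(real^'n) set \<Rightarrow> (real^'n) set" where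
  "Gen \<tau> = ray_generator ` {\<rho>. cone_face \<rho> \<tau> \<and> dim \<rho> = 1}"

definition smooth_cone :: "(real^'n) set \<Rightarrow> bool" where
  "smooth_cone \<tau> \<longleftrightarrow> (\<exists>B. lattice_basis B \<and> Gen \<tau> \<subseteq> B)"

definition fan :: "(real^'n) set set \<Rightarrow> bool" where
  "fan \<Sigma> \<longleftrightarrow> finite \<Sigma> \<and> (\<forall>\<tau>\<in>\<Sigma>. toric_cone \<tau>) \<and>
     (\<forall>\<tau>\<in>\<Sigma>. \<forall>\<rho>. cone_face \<rho> \<tau> \<longrightarrow> \<rho> \<in> \<Sigma>) \<and>
     (\<forall>\<tau>\<in>\<Sigma>. \<forall>\<tau>'\<in>\<Sigma>. cone_face (\<tau> \<inter> \<tau>') \<tau> \<and> cone_face (\<tau> \<inter> \<tau>') \<tau>')"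

definition smooth_fan :: "(real^'n) set set \<Rightarrow> bool" where
  "smooth_fan \<Sigma> \<longleftrightarrow> fan \<Sigma> \<and> (\<forall>\<tau>\<in>\<Sigma>. smooth_cone \<tau>)"

definition fan_Gen :: "(real^'n) set set \<Rightarrow> (real^'n) set" where
  "fan_Gen \<Sigma> = (\<Union>\<tau>\<in>\<Sigma>. Gen \<tau>)"

definition subdivision :: "(real^'n) set set \<Rightarrow> (real^'n) set \<Rightarrow> bool" where
  "subdivision \<Sigma> \<sigma> \<longleftrightarrow> fan \<Sigma> \<and> \<Union>\<Sigma> = \<sigma>"

definition Hilb :: "(real^'n) set \<Rightarrow> (real^'n) set" where
  "Hilb \<sigma> = {n \<in> \<sigma> \<inter> int_lattice - {0}.
     \<forall>n\<^sub>1\<in>\<sigma> \<inter> int_lattice. \<forall>n\<^sub>2\<in>\<sigma> \<inter> int_lattice. n = n\<^sub>1 + n\<^sub>2 \<longrightarrow> n\<^sub>1 = 0 \<or> n\<^sub>2 = 0}"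

definition Hilbert_basis_resolution :: "(real^'n) set set \<Rightarrow> (real^'n) set \<Rightarrow> bool" where
  "Hilbert_basis_resolution \<Sigma> \<sigma> \<longleftrightarrow>
     subdivision \<Sigma> \<sigma> \<and> smooth_fan \<Sigma> \<and> fan_Gen \<Sigma> = Hilb \<sigma>"

lemma cone_face_iff_supporting:
  assumes "toric_cone \<sigma>"
  shows "cone_face \<tau> \<sigma> \<longleftrightarrow>
    (\<exists>m. (\<forall>x\<in>\<sigma>. 0 \<le> m \<bullet> x) \<and> \<tau> = \<sigma> \<inter> {x. m \<bullet> x = 0})"
proof -
  obtain S where S: "finite S" "\<sigma> = convex_cone hull S"
    using assms by (auto simp: toric_cone_def)
  have poly: "polyhedron \<sigma>"
    using S polyhedron_convex_cone_hull by blast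
  have zero: "0 \<in> \<sigma>" and cvx: "convex \<sigma>"
    using S by (auto simp: convex_cone_hull_contains_0 convex_convex_cone_hull)
  have scl: "c *\<^sub>R x \<in> \<sigma>" if "0 \<le> c" "x \<in> \<sigma>" for c x
    using that S by (simp add: convex_cone_hull_mul)
  show ?thesis
  proof
    assume "cone_face \<tau> \<sigma>"
    then have f: "\<tau> face_of \<sigma>" and ne: "\<tau> \<noteq> {}"
      by (auto simp: cone_face_def)
    then obtain a b where ab: "\<sigma> \<subseteq> {x. a \<bullet> x \<le> b}" "\<tau> = \<sigma> \<inter> {x. a \<bullet> x = b}"
      using exposed_face_of_polyhedron[OF poly] unfolding exposed_face_of_def by metis
    obtain y where y: "y \<in> \<sigma>" "a \<bullet> y = b"
      using ne ab by auto
    have "0 \<le> b" using ab zero by force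
    moreover have "a \<bullet> (2 *\<^sub>R y) \<le> b"
      using ab(1) scl[of 2 y] y(1) by auto
    ultimately have "b = 0" using y by simp
    then have "(\<forall>x\<in>\<sigma>. 0 \<le> (- a) \<bullet> x) \<and> \<tau> = \<sigma> \<inter> {x. (- a) \<bullet> x = 0}"
      using ab by auto
    then show "\<exists>m. (\<forall>x\<in>\<sigma>. 0 \<le> m \<bullet> x) \<and> \<tau> = \<sigma> \<inter> {x. m \<bullet> x = 0}" by blast
  next
    assume "\<exists>m. (\<forall>x\<in>\<sigma>. 0 \<le> m \<bullet> x) \<and> \<tau> = \<sigma> \<inter> {x. m \<bullet> x = 0}"
    then obtain m where m: "\<forall>x\<in>\<sigma>. 0 \<le> m \<bullet> x" "\<tau> = \<sigma> \<inter> {x. m \<bullet> x = 0}" by blast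
    then have "\<tau> face_of \<sigma>"
      using face_of_Int_supporting_hyperplane_ge[OF cvx, of 0 m] by auto
    moreover have "0 \<in> \<tau>" using m zero by simp
    ultimately show "cone_face \<tau> \<sigma>" by (auto simp: cone_face_def)
  qed
qed

lemma ex1_primitive:
  fixes \<rho> :: "(real^'n) set"
  assumes cone: "toric_cone \<rho>" and dim: "dim \<rho> = 1"
  shows "\<exists>!n. n \<in> \<rho> \<and> primitive n"
proof -
  obtain S where S: "S \<subseteq> int_lattice" "\<rho> = convex_cone hull S"
    using cone by (auto simp: toric_cone_def)
  have pointed: "x = 0" if "x \<in> \<rho>" "- x \<in> \<rho>" for x
    using cone that by (auto simp: toric_cone_def)
  have scl: "c *\<^sub>R x \<in> \<rho>" if "0 \<le> c" "x \<in> \<rho>" for c x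
    using that S by (simp add: convex_cone_hull_mul)
  have "\<not> S \<subseteq> {0}"
  proof
    assume "S \<subseteq> {0}"
    then have "\<rho> \<subseteq> {0}"
      using S by (metis convex_cone_singleton hull_minimal)
    then show False
      using dim dim_subset[of \<rho> "{0}"] by simp
  qed
  then obtain s where s: "s \<in> S" "s \<noteq> 0" by blast
  have s\<rho>: "s \<in> \<rho>" and sL: "s \<in> int_lattice"
    using s S by (auto simp: hull_inc)
  have "\<rho> \<subseteq> span {s}"
    using card_ge_dim_independent[of "{s}" \<rho>] s s\<rho> dim by auto
  have ray: "\<exists>c\<ge>0. x = c *\<^sub>R s" if "x \<in> \<rho>" for x
  proof -
    obtain c where c: "x = c *\<^sub>R s"
      using \<open>\<rho> \<subseteq> span {s}\<close> \<open>x \<in> \<rho>\<close> unfolding span_singleton by blast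
    have "0 \<le> c"
    proof (rule ccontr)
      assume "\<not> 0 \<le> c"
      then have "- s = (- 1 / c) *\<^sub>R x" "0 \<le> - 1 / c"
        using c by (auto simp: divide_simps)
      then have "- s \<in> \<rho>" using scl that by metis
      then show False using pointed s\<rho> s by blast
    qed
    with c show ?thesis by blast
  qed
  define K where "K = {k::nat. 0 < k \<and> (\<exists>m\<in>int_lattice. s = of_nat k *\<^sub>R m)}"
  obtain i where i: "s $ i \<noteq> 0"
    using s by (metis vec_eq_iff zero_index)
  have "k \<le> nat \<lceil>\<bar>s $ i\<bar>\<rceil>" if "k \<in> K" for k
  proof -
    obtain m where m: "0 < k" "m \<in> int_lattice" "s = of_nat k *\<^sub>R m"
      using \<open>k \<in> K\<close> by (auto simp: K_def)
    have "m $ i \<in> \<int>" "m $ i \<noteq> 0"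
      using m i by (auto simp: int_lattice_def)
    then have "1 \<le> \<bar>m $ i\<bar>" using Ints_nonzero_abs_ge1 by blast
    then have "real k * 1 \<le> real k * \<bar>m $ i\<bar>" by (intro mult_left_mono) auto
    then have "real k \<le> \<bar>s $ i\<bar>" using m by (simp add: abs_mult)
    then show ?thesis by linarith
  qed
  then have fin: "finite K"
    by (meson finite_nat_set_iff_bounded_le)
  have "1 \<in> K" using sL by (auto simp: K_def)
  define k where "k = Max K"
  have "k \<in> K" using fin \<open>1 \<in> K\<close> by (auto simp: k_def intro: Max_in)
  then obtain m where m: "0 < k" "m \<in> int_lattice" "s = of_nat k *\<^sub>R m"
    by (auto simp: K_def)
  have "m = (1 / real k) *\<^sub>R s" using m by simp
  then have "m \<in> \<rho>" using scl[of "1 / real k" s] s\<rho> by simp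
  have "j = 1" if m': "m' \<in> int_lattice" "m = of_nat j *\<^sub>R m'" for j :: nat and m'
  proof -
    have "j \<noteq> 0" using m m' s by (intro notI) simp
    then have "k * j \<in> K" using m m' by (auto simp: K_def intro!: bexI[of _ m'])
    then have "k * j \<le> k * 1" using fin by (simp add: k_def)
    then show ?thesis using m(1) \<open>j \<noteq> 0\<close> by simp
  qed
  moreover have "m \<noteq> 0" using m s by auto
  ultimately have "primitive m"
    using m(2) unfolding primitive_def by blast
  moreover have "x = y" if x: "x \<in> \<rho>" "primitive x" and y: "y \<in> \<rho>" "primitive y" for x y
  proof -
    have x': "x \<in> int_lattice" "x \<noteq> 0" "\<And>k m. m \<in> int_lattice \<Longrightarrow> x = of_nat k *\<^sub>R m \<Longrightarrow> k = 1"
      using x(2) unfolding primitive_def by blast+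
    have y': "y \<in> int_lattice" "y \<noteq> 0" "\<And>k m. m \<in> int_lattice \<Longrightarrow> y = of_nat k *\<^sub>R m \<Longrightarrow> k = 1"
      using y(2) unfolding primitive_def by blast+
    obtain c d where c: "0 \<le> c" "x = c *\<^sub>R s" and d: "0 \<le> d" "y = d *\<^sub>R s"
      using ray x y by meson
    have "c \<noteq> 0" "d \<noteq> 0" using c d x'(2) y'(2) by auto
    define t where "t = c / d"
    have t: "0 < t" "x = t *\<^sub>R y"
      using c d \<open>c \<noteq> 0\<close> \<open>d \<noteq> 0\<close> by (auto simp: t_def)
    obtain i where i: "y $ i \<noteq> 0"
      using y'(2) by (metis vec_eq_iff zero_index)
    have "t = x $ i / y $ i" using t i by simp
    moreover have "x $ i \<in> \<rat>" "y $ i \<in> \<rat>"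
      using x'(1) y'(1) Ints_subset_Rats by (auto simp: int_lattice_def)
    ultimately have "t \<in> \<rat>" by simp
    then obtain p q :: nat where pq: "q \<noteq> 0" "\<bar>t\<bar> = real p / real q" "coprime p q"
      by (rule Rats_abs_nat_div_natE)
    obtain u v :: int where uv: "u * int p + v * int q = 1"
      using bezout_int[of "int p" "int q"] pq(3) by auto
    define w where "w = of_int u *\<^sub>R x + of_int v *\<^sub>R y"
    have wL: "w \<in> int_lattice"
      using x'(1) y'(1) by (auto simp: w_def int_lattice_def)
    have tpq: "t = real p / real q" using pq t by simp
    have "real_of_int (u * int p + v * int q) = 1" using uv by simp
    then have "of_int u * real p + of_int v * real q = 1" by simp
    then have "of_int u * t + of_int v = 1 / real q"
      using pq(1) by (simp add: tpq field_simps)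
    moreover have "w = (of_int u * t + of_int v) *\<^sub>R y"
      by (simp add: w_def t(2) scaleR_left_distrib)
    ultimately have w: "w = (1 / real q) *\<^sub>R y" by simp
    have "y = of_nat q *\<^sub>R w" using pq(1) by (simp add: w)
    moreover have "x = of_nat p *\<^sub>R w" by (simp add: w t(2) tpq)
    ultimately show "x = y" using x'(3)[OF wL] y'(3)[OF wL] by metis
  qed
  ultimately show ?thesis using \<open>m \<in> \<rho>\<close> by blast
qed

end

theory Submission
  imports Defs
begin

text \<open>
  The cone is a join of two planar cones, one spanned by \<open>e\<^sub>1, e\<^sub>4\<close> and one by \<open>e\<^sub>2, e\<^sub>3\<close>. Give each
  side a height and a position, so that the generators have height \<open>1\<close> on their own side, height \<open>0\<close>
  on the other, and positions \<open>0\<close> and \<open>r\<close>. In these four linear coordinates the cone is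
  \<open>0 \<le> pos1 \<le> r ht1, 0 \<le> pos2 \<le> r ht2\<close>, and the lattice consists of the integral vectors with
  \<open>pos2\<close> congruent to \<open>a pos1\<close> modulo \<open>r\<close> (lemmas \<open>mem_join\<close>, \<open>lattice_pt\<close>). The Hilbert basis lies
  among the four \<open>e\<^sub>i\<close> and the points \<open>h\<^sub>1, \<dots>, h\<^bsub>r-1\<^esub>\<close>, where \<open>h\<^sub>t\<close> has both heights \<open>1\<close> and positions
  \<open>t\<close> and \<open>a t mod r\<close> (lemma \<open>Hilb_cases\<close>).

  Suppose that there is a Hilbert basis resolution. Dividing the lattice by \<open>e\<^sub>1, e\<^sub>4\<close> leaves \<open>ht2\<close> and
  \<open>pos2\<close> as integral coordinates, so a smooth cone that contains \<open>e\<^sub>1\<close> and \<open>e\<^sub>4\<close> can only have further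
  generators at adjacent values of \<open>pos2\<close>. A point far out in the direction \<open>e\<^sub>1 + e\<^sub>4\<close> lies in a cone
  that contains both, hence any two \<open>h\<close>'s whose values of \<open>pos2\<close> are \<open>l\<close> and \<open>l + 1\<close> lie in a common
  cone of the fan (\<open>section_of_side1\<close>). With the sides exchanged, so do any two \<open>h\<close>'s with consecutive
  values of \<open>pos1\<close> (\<open>section_of_side2\<close>).

  In the square where both heights are \<open>1\<close>, the fan therefore contains two paths through all the points
  \<open>h\<^sub>t\<close>: one runs through them in the order of \<open>pos1\<close>, the other in the order of \<open>pos2\<close>. For
  \<open>1 < a < r - a\<close> these paths cross, which a fan does not allow. Concretely, let \<open>m = r div a\<close>. Along the
  first path, \<open>pos2\<close> grows in steps of \<open>a\<close> up to \<open>h\<^sub>m\<close> and then drops by \<open>r - a\<close> to \<open>h\<^bsub>m+1\<^esub>\<close>. At levels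
  strictly between these two, the second path visits \<open>h\<^sub>1\<close> on the left and \<open>h\<^bsub>m+2\<^esub>\<close> on the right of that
  long segment, so one of its short segments crosses the long one. The fan axioms then put \<open>h\<^sub>m\<close> into a
  cone on which \<open>pos2 / ht2\<close> ranges over an interval \<open>[l, l + 1]\<close> below the level of \<open>h\<^sub>m\<close>.
\<close>

section \<open>Generators of polyhedral cones\<close>

lemma linear_nonneg_on_hull:
  fixes f :: "real^'n \<Rightarrow> real"
  assumes "linear f" "\<And>g. g \<in> G \<Longrightarrow> 0 \<le> f g" "x \<in> convex_cone hull G"
  shows "0 \<le> f x"
proof -
  have "convex_cone {x. 0 \<le> f x}"
    using assms(1) unfolding convex_cone_iff by (auto simp: linear_add linear_scale linear_0)
  then have "convex_cone hull G \<subseteq> {x. 0 \<le> f x}"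
    using assms(2) by (intro hull_minimal) auto
  then show ?thesis using assms(3) by auto
qed

lemma convex_cone_hull_singleton:
  "convex_cone hull {s} = {c *\<^sub>R s | c. 0 \<le> (c::real)}"
proof -
  have "0 \<in> {c *\<^sub>R s | c. 0 \<le> c}" by (auto intro!: exI[of _ 0])
  then show ?thesis
    unfolding convex_cone_hull_separate conic_hull_explicit by auto
qed

text \<open>
  If two elements of the cone add up to a multiple of \<open>s\<close>, then their parts in \<open>convex_cone hull S\<close> add
  up to some \<open>d *\<^sub>R s\<close>. Irredundancy excludes \<open>d > 0\<close>, and for \<open>d \<le> 0\<close> both parts vanish because the
  cone is pointed.
\<close>

lemma irredundant_generator_spans_face:
  fixes s :: "real^'n"
  assumes pointed: "\<And>x. x \<in> convex_cone hull insert s S \<Longrightarrow> - x \<in> convex_cone hull insert s S \<Longrightarrow> x = 0"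
    and irr: "s \<notin> convex_cone hull S"
  shows "cone_face (convex_cone hull {s}) (convex_cone hull insert s S)"
proof -
  let ?\<tau> = "convex_cone hull insert s S" and ?\<rho> = "convex_cone hull {s}"
  have sub: "?\<rho> \<subseteq> ?\<tau>" "convex_cone hull S \<subseteq> ?\<tau>" by (intro hull_mono; auto)+
  have "?\<tau> = convex_cone hull ({s} \<union> S)" by simp
  then have decomp: "\<exists>\<alpha> x'. 0 \<le> \<alpha> \<and> x' \<in> convex_cone hull S \<and> x = \<alpha> *\<^sub>R s + x'" if "x \<in> ?\<tau>" for x
    using that unfolding convex_cone_hull_Un by (auto simp: convex_cone_hull_singleton)
  have key: "x' = 0"
    if x': "x' \<in> convex_cone hull S" and y': "y' \<in> convex_cone hull S" and pos: "0 < t" "0 \<le> t'"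
      and eq: "t *\<^sub>R x' + t' *\<^sub>R y' = d *\<^sub>R s" for x' y' t t' d
  proof (cases "0 < d")
    case True
    have "d *\<^sub>R s \<in> convex_cone hull S"
      unfolding eq[symmetric] using x' y' pos by (intro convex_cone_hull_add convex_cone_hull_mul) auto
    from convex_cone_hull_mul[OF this, of "1 / d"]
    have "(1 / d) *\<^sub>R d *\<^sub>R s \<in> convex_cone hull S"
      using True by simp
    then show ?thesis using True irr by simp
  next
    case False
    have "t' *\<^sub>R y' + (- d) *\<^sub>R s \<in> ?\<tau>"
      using False pos y' sub(2) by (intro convex_cone_hull_add convex_cone_hull_mul) (auto intro: hull_inc)
    moreover have "t' *\<^sub>R y' + (- d) *\<^sub>R s = - (t *\<^sub>R x')"
      using eq by (simp add: algebra_simps)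
    moreover have "t *\<^sub>R x' \<in> ?\<tau>"
      using x' sub(2) pos by (intro convex_cone_hull_mul) auto
    ultimately have "t *\<^sub>R x' = 0" using pointed by metis
    then show ?thesis using pos by simp
  qed
  have "?\<rho> face_of ?\<tau>"
    unfolding face_of_def
  proof (intro conjI ballI impI)
    fix x y z assume x: "x \<in> ?\<tau>" and y: "y \<in> ?\<tau>" and z: "z \<in> ?\<rho>" and seg: "z \<in> open_segment x y"
    obtain \<alpha> x' where \<alpha>: "0 \<le> \<alpha>" "x' \<in> convex_cone hull S" "x = \<alpha> *\<^sub>R s + x'" using decomp x by blast
    obtain \<beta> y' where \<beta>: "0 \<le> \<beta>" "y' \<in> convex_cone hull S" "y = \<beta> *\<^sub>R s + y'" using decomp y by blast
    obtain c where c: "z = c *\<^sub>R s" using z by (auto simp: convex_cone_hull_singleton)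
    obtain u where u: "0 < u" "u < 1" "z = (1 - u) *\<^sub>R x + u *\<^sub>R y"
      using seg by (auto simp: in_segment)
    have eq: "(1 - u) *\<^sub>R x' + u *\<^sub>R y' = (c - (1 - u) * \<alpha> - u * \<beta>) *\<^sub>R s"
      using u(3) unfolding c \<alpha>(3) \<beta>(3) by (simp add: algebra_simps)
    have "x' = 0" using key[OF \<alpha>(2) \<beta>(2) _ _ eq] u by simp
    moreover have "y' = 0"
      using key[OF \<beta>(2) \<alpha>(2) _ _ eq[unfolded add.commute[of "(1 - u) *\<^sub>R x'"]]] u by simp
    ultimately have "x \<in> ?\<rho> \<and> y \<in> ?\<rho>"
      using \<alpha> \<beta> by (auto simp: convex_cone_hull_singleton)
    then show "x \<in> ?\<rho>" "y \<in> ?\<rho>" by auto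
  qed (use sub convex_convex_cone_hull in auto)
  then show ?thesis using convex_cone_hull_contains_0 unfolding cone_face_def by blast
qed

lemma toric_cone_ray:
  assumes "s \<in> int_lattice" "s \<noteq> 0"
  shows "toric_cone (convex_cone hull {s})" "dim (convex_cone hull {s}) = 1"
proof -
  have "c *\<^sub>R s = 0" if "0 \<le> c" "0 \<le> d" "- (c *\<^sub>R s) = d *\<^sub>R s" for c d
  proof -
    have "(c + d) *\<^sub>R s = c *\<^sub>R s + d *\<^sub>R s" by (rule scaleR_left_distrib)
    also have "\<dots> = 0" unfolding that(3)[symmetric] by simp
    finally show ?thesis using assms that by auto
  qed
  then show "toric_cone (convex_cone hull {s})"
    using assms unfolding toric_cone_def
    by (intro conjI exI[of _ "{s}"]) (auto simp: convex_cone_hull_singleton[of s])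
  have "convex_cone hull {s} \<subseteq> span {s}"
    by (auto simp: convex_cone_hull_singleton span_singleton)
  then have "dim (convex_cone hull {s}) \<le> dim {s}"
    using dim_subset[of "convex_cone hull {s}" "span {s}"] by (simp only: dim_span)
  moreover have "dim {s} \<le> dim (convex_cone hull {s})"
    by (intro dim_subset) (auto intro: hull_inc)
  ultimately show "dim (convex_cone hull {s}) = 1" using assms by simp
qed

text \<open>
  In a generating set of least cardinality every element spans a one-dimensional face, and replacing
  it by the primitive vector on that face does not change the hull.
\<close>

lemma toric_cone_generated_by_Gen:
  assumes "toric_cone \<tau>"
  obtains G where "G \<subseteq> Gen \<tau>" "\<tau> = convex_cone hull G"
proof -
  let ?P = "\<lambda>S. finite S \<and> S \<subseteq> int_lattice \<and> \<tau> = convex_cone hull S"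
  obtain S0 where "?P S0" using assms unfolding toric_cone_def by auto
  from ex_has_least_nat[of ?P, OF this, of card]
  obtain S where S: "?P S" and min: "\<And>S'. ?P S' \<Longrightarrow> card S \<le> card S'" by auto
  have pointed: "x = 0" if "x \<in> \<tau>" "- x \<in> \<tau>" for x
    using assms that unfolding toric_cone_def by blast
  let ?g = "\<lambda>s. ray_generator (convex_cone hull {s})"
  have gen: "?g s \<in> Gen \<tau>" "s \<in> convex_cone hull {?g s}" "?g s \<in> convex_cone hull {s}" if s: "s \<in> S" for s
  proof -
    have ins: "insert s (S - {s}) = S" using s by auto
    have irr: "s \<notin> convex_cone hull (S - {s})"
    proof
      assume "s \<in> convex_cone hull (S - {s})"
      then have "?P (S - {s})" using hull_redundant[of s convex_cone "S - {s}"] S ins by auto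
      then have "card S \<le> card (S - {s})" by (rule min)
      then show False using S s by (meson card_Diff1_less not_less)
    qed
    have "s \<noteq> 0" using irr convex_cone_hull_contains_0 by metis
    then have ray: "toric_cone (convex_cone hull {s})" "dim (convex_cone hull {s}) = 1"
      using toric_cone_ray S s by blast+
    have "cone_face (convex_cone hull {s}) \<tau>"
      using irredundant_generator_spans_face[of s "S - {s}"] irr pointed S unfolding ins by metis
    then show "?g s \<in> Gen \<tau>" using ray unfolding Gen_def by blast
    have g: "?g s \<in> convex_cone hull {s}" "primitive (?g s)"
      using theI'[OF ex1_primitive[OF ray]] unfolding ray_generator_def by blast+
    show "?g s \<in> convex_cone hull {s}" by fact
    then obtain c where c: "0 \<le> c" "?g s = c *\<^sub>R s" by (auto simp: convex_cone_hull_singleton)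
    have "c \<noteq> 0" using g c unfolding primitive_def by auto
    then have "s = (1 / c) *\<^sub>R ?g s" unfolding c(2) by simp
    moreover have "0 \<le> 1 / c" using c by simp
    ultimately show "s \<in> convex_cone hull {?g s}"
      unfolding convex_cone_hull_singleton by blast
  qed
  have "s \<in> convex_cone hull (?g ` S)" if s: "s \<in> S" for s
    using gen(2)[OF s] hull_mono[of "{?g s}" "?g ` S" convex_cone] s by blast
  moreover have "?g s \<in> convex_cone hull S" if s: "s \<in> S" for s
    using gen(3)[OF s] hull_mono[of "{s}" S convex_cone] s by blast
  ultimately have "convex_cone hull S = convex_cone hull (?g ` S)"
    by (intro subset_antisym hull_minimal convex_cone_convex_cone_hull) auto
  then show ?thesis using that[of "?g ` S"] gen(1) S by auto
qed

section \<open>Unimodularity\<close>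

text \<open>
  The integral coordinate with respect to \<open>b\<close> is additive on the lattice, so it is determined by its
  values on the standard basis, and these values define the real functional.
\<close>

lemma lattice_basis_dual_functional:
  fixes B :: "(real^'n) set"
  assumes "lattice_basis B" "b \<in> B"
  obtains \<phi> :: "real^'n \<Rightarrow> real" where "linear \<phi>" "\<phi> b = 1"
    "\<And>b'. b' \<in> B \<Longrightarrow> b' \<noteq> b \<Longrightarrow> \<phi> b' = 0" "\<And>x. x \<in> int_lattice \<Longrightarrow> \<phi> x \<in> \<int>"
proof -
  have ind: "zmod.independent B" and span: "zmod.span B = int_lattice"
    using assms unfolding lattice_basis_def by auto
  define c where "c x = zmod.representation B x b" for x
  define \<phi> :: "real^'n \<Rightarrow> real" where "\<phi> x = (\<Sum>i\<in>UNIV. x $ i * of_int (c (axis i 1)))" for x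
  have ax: "axis i 1 \<in> (int_lattice :: (real^'n) set)" for i by (auto simp: int_lattice_def axis_def)
  have c_sum: "c (\<Sum>i\<in>I. of_int (k i) *\<^sub>R axis i 1) = (\<Sum>i\<in>I. k i * c (axis i 1))" for I k
  proof -
    have "of_int (k i) *\<^sub>R axis i 1 \<in> zmod.span B" for i
      using ax span by (intro zmod.span_scale) auto
    then have "c (\<Sum>i\<in>I. of_int (k i) *\<^sub>R axis i 1) = (\<Sum>i\<in>I. c (of_int (k i) *\<^sub>R axis i 1))"
      unfolding c_def using zmod.representation_sum[OF ind, of I "\<lambda>i. of_int (k i) *\<^sub>R axis i 1"]
      by (simp only:)
    also have "\<dots> = (\<Sum>i\<in>I. k i * c (axis i 1))"
      unfolding c_def using zmod.representation_scale[OF ind] ax span by auto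
    finally show ?thesis .
  qed
  have agree: "\<phi> x = of_int (c x)" if x: "x \<in> int_lattice" for x
  proof -
    have fl: "x $ i = of_int \<lfloor>x $ i\<rfloor>" for i
      using x by (auto simp: int_lattice_def)
    have "x = (\<Sum>i\<in>UNIV. x $ i *\<^sub>R axis i 1)"
      by (simp add: vec_eq_iff axis_def if_distrib[of "(*) _"] cong: if_cong)
    then have "x = (\<Sum>i\<in>UNIV. of_int \<lfloor>x $ i\<rfloor> *\<^sub>R axis i 1)" using fl by simp
    then have "c x = (\<Sum>i\<in>UNIV. \<lfloor>x $ i\<rfloor> * c (axis i 1))" using c_sum by metis
    then have "of_int (c x) = (\<Sum>i\<in>UNIV. of_int \<lfloor>x $ i\<rfloor> * real_of_int (c (axis i 1)))" by simp
    then show ?thesis using fl unfolding \<phi>_def by simp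
  qed
  have BL: "B \<subseteq> int_lattice" using zmod.span_superset[of B] span by simp
  show thesis
  proof (rule that)
    show "linear \<phi>" unfolding \<phi>_def
      by (rule linearI) (auto simp: algebra_simps sum.distrib sum_distrib_left)
    show "\<phi> b = 1" "\<And>b'. b' \<in> B \<Longrightarrow> b' \<noteq> b \<Longrightarrow> \<phi> b' = 0"
      using BL assms(2) agree zmod.representation_basis[OF ind] unfolding c_def by auto
    show "\<And>x. x \<in> int_lattice \<Longrightarrow> \<phi> x \<in> \<int>" using agree by auto
  qed
qed

text \<open>
  Here \<open>h\<close> and \<open>p\<close> play the part of integral coordinates on the quotient of the lattice by \<open>c0\<close> and
  \<open>c1\<close>. The functional dual to \<open>u\<close> kills \<open>c0\<close> and \<open>c1\<close>, so it has the form \<open>\<alpha> h + \<beta> p\<close>; comparing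
  its values \<open>1\<close> at \<open>u\<close> and \<open>0\<close> at \<open>v\<close> gives \<open>\<beta> (p u - p v) = 1\<close> in integers.
\<close>

lemma unimodular_adjacent:
  fixes u v c0 c1 :: "real^'n" and h p :: "real^'n \<Rightarrow> real"
  assumes B: "lattice_basis B" "c0 \<in> B" "c1 \<in> B" "u \<in> B" "v \<in> B" "u \<noteq> v" "u \<noteq> c0" "u \<noteq> c1"
    and hp: "\<And>\<phi>. linear \<phi> \<Longrightarrow> \<phi> c0 = 0 \<Longrightarrow> \<phi> c1 = 0 \<Longrightarrow> (\<And>x. x \<in> int_lattice \<Longrightarrow> \<phi> x \<in> \<int>)
      \<Longrightarrow> \<exists>\<alpha> \<beta>. \<beta> \<in> \<int> \<and> (\<forall>x. \<phi> x = \<alpha> * h x + \<beta> * p x)"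
    and uv: "h u = 1" "h v = 1" "p u \<in> \<int>" "p v \<in> \<int>"
  shows "\<bar>p u - p v\<bar> = 1"
proof -
  obtain \<phi> :: "real^'n \<Rightarrow> real" where \<phi>: "linear \<phi>" "\<phi> u = 1"
    "\<And>b'. b' \<in> B \<Longrightarrow> b' \<noteq> u \<Longrightarrow> \<phi> b' = 0" "\<And>x. x \<in> int_lattice \<Longrightarrow> \<phi> x \<in> \<int>"
    using lattice_basis_dual_functional[OF B(1,4)] by metis
  obtain \<alpha> \<beta> where \<beta>: "\<beta> \<in> \<int>" "\<And>x. \<phi> x = \<alpha> * h x + \<beta> * p x"
    using hp[of \<phi>] \<phi> B by metis
  have "\<phi> u - \<phi> v = 1" using \<phi> B by auto
  then have 1: "\<beta> * (p u - p v) = 1" using \<beta>(2) uv by (simp add: algebra_simps)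
  have "p u - p v \<in> \<int>" using uv by simp
  then obtain m n :: int where mn: "\<beta> = of_int m" "p u - p v = of_int n"
    using \<beta>(1) by (auto elim!: Ints_cases)
  then have "m * n = 1" using 1 by (metis of_int_eq_1_iff of_int_mult)
  then have "n = 1 \<or> n = - 1" by (auto simp: zmult_eq_1_iff)
  then show ?thesis unfolding mn(2) by auto
qed

text \<open>
  The conditions on \<open>F x\<close> and \<open>f x\<close> say that \<open>x\<close> lies far out in the direction \<open>c0 + c1\<close>: a cone of this
  kind in which \<open>c0\<close> or \<open>c1\<close> is missing satisfies a linear inequality that fails at \<open>x\<close>. Likewise the
  mean value \<open>l + 1/2\<close> of \<open>p / h\<close> at \<open>x\<close> forces generators with \<open>p \<le> l\<close> and with \<open>p \<ge> l + 1\<close>, and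
  adjacency leaves no room for values other than \<open>l\<close> and \<open>l + 1\<close>.
\<close>

lemma consecutive_sections:
  fixes f F h p :: "real^'n \<Rightarrow> real" and r :: real and l :: int
  assumes lin: "linear f" "linear F" "linear h" "linear p" and r: "0 < r"
    and c0: "f c0 = 1" "F c0 = 0" "h c0 = 0" "p c0 = 0"
    and c1: "f c1 = 1" "F c1 = r" "h c1 = 0" "p c1 = 0"
    and gens: "\<And>g. g \<in> G \<Longrightarrow> g = c0 \<or> g = c1 \<or> h g = 1 \<and> p g \<in> \<int> \<and> F g \<le> r \<and> r * f g - F g \<le> r"
    and adj: "\<And>u v. \<lbrakk>c0 \<in> G; c1 \<in> G; u \<in> G; v \<in> G; u \<noteq> v; h u = 1; h v = 1\<rbrakk> \<Longrightarrow> \<bar>p u - p v\<bar> = 1"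
    and x: "x \<in> convex_cone hull G" "h x = 2" "p x = 2 * of_int l + 1" "2 * r < F x" "2 * r < r * f x - F x"
  obtains u v where "u \<in> G" "v \<in> G" "h u = 1" "h v = 1" "p u = of_int l" "p v = of_int l + 1"
    "\<And>y. y \<in> convex_cone hull G \<Longrightarrow> of_int l * h y \<le> p y \<and> p y \<le> (of_int l + 1) * h y"
proof -
  have linc: "linear (\<lambda>x. \<alpha> * f x + \<beta> * F x + \<gamma> * h x + \<delta> * p x)" for \<alpha> \<beta> \<gamma> \<delta> :: real
    by (rule linearI) (simp_all add: lin linear_add linear_scale algebra_simps)
  have bound: "0 \<le> \<alpha> * f y + \<beta> * F y + \<gamma> * h y + \<delta> * p y"
    if "y \<in> convex_cone hull G" "\<And>g. g \<in> G \<Longrightarrow> 0 \<le> \<alpha> * f g + \<beta> * F g + \<gamma> * h g + \<delta> * p g" for \<alpha> \<beta> \<gamma> \<delta> y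
    using linear_nonneg_on_hull[OF linc that(2,1)] by blast
  \<comment> \<open>Without \<open>c0\<close>, the cone lies in the half-space \<open>r f - F \<le> r h\<close>.\<close>
  have c0G: "c0 \<in> G"
  proof (rule ccontr)
    assume "c0 \<notin> G"
    then have "0 \<le> (- r) * f g + 1 * F g + r * h g + 0 * p g" if "g \<in> G" for g
      using gens[OF that] that c0 c1 by auto
    from bound[OF x(1) this] show False using x by simp
  qed
  \<comment> \<open>Without \<open>c1\<close>, the cone lies in the half-space \<open>F \<le> r h\<close>.\<close>
  have c1G: "c1 \<in> G"
  proof (rule ccontr)
    assume "c1 \<notin> G"
    then have "0 \<le> 0 * f g + (- 1) * F g + r * h g + 0 * p g" if "g \<in> G" for g
      using gens[OF that] that c0 c1 by auto
    from bound[OF x(1) this] show False using x by simp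
  qed
  have step: "of_int l + 1 \<le> p g \<or> p g \<le> of_int l" if g: "g \<in> G" "h g = 1" for g
  proof -
    have "p g \<in> \<int>" using gens[of g] g c0 c1 by auto
    then obtain n where "p g = of_int n" by (auto elim: Ints_cases)
    then show ?thesis by (metis add1_zle_eq not_le of_int_1 of_int_add of_int_le_iff)
  qed
  have "\<exists>u\<in>G. h u = 1 \<and> p u \<le> of_int l"
  proof (rule ccontr)
    assume no: "\<not> ?thesis"
    have "0 \<le> 0 * f g + 0 * F g + (- (of_int l + 1)) * h g + 1 * p g" if "g \<in> G" for g
      using gens[OF that] step[OF that] that c0 c1 no by force
    from bound[OF x(1) this] show False using x by (simp add: algebra_simps)
  qed
  then obtain u where u: "u \<in> G" "h u = 1" "p u \<le> of_int l" by blast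
  have "\<exists>v\<in>G. h v = 1 \<and> of_int l + 1 \<le> p v"
  proof (rule ccontr)
    assume no: "\<not> ?thesis"
    have "0 \<le> 0 * f g + 0 * F g + of_int l * h g + (- 1) * p g" if "g \<in> G" for g
      using gens[OF that] step[OF that] that c0 c1 no by force
    from bound[OF x(1) this] show False using x by simp
  qed
  then obtain v where v: "v \<in> G" "h v = 1" "of_int l + 1 \<le> p v" by blast
  have "\<bar>p u - p v\<bar> = 1" using adj[OF c0G c1G u(1) v(1)] u v by force
  then have pu: "p u = of_int l" and pv: "p v = of_int l + 1" using u v by linarith+
  have two: "p g = of_int l \<or> p g = of_int l + 1" if g: "g \<in> G" "h g = 1" for g
  proof (cases "g = u \<or> g = v")
    case False
    then have "\<bar>p g - p u\<bar> = 1" "\<bar>p g - p v\<bar> = 1" using adj[OF c0G c1G] g u v by auto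
    then show ?thesis using pu pv by linarith
  qed (use pu pv in auto)
  have "of_int l * h y \<le> p y \<and> p y \<le> (of_int l + 1) * h y" if y: "y \<in> convex_cone hull G" for y
  proof -
    have "0 \<le> 0 * f g + 0 * F g + (- of_int l) * h g + 1 * p g" if "g \<in> G" for g
      using gens[OF that] two[OF that] c0 c1 by auto
    note 1 = bound[OF y this]
    have "0 \<le> 0 * f g + 0 * F g + (of_int l + 1) * h g + (- 1) * p g" if "g \<in> G" for g
      using gens[OF that] two[OF that] c0 c1 by auto
    note 2 = bound[OF y this]
    show ?thesis using 1 2 by simp
  qed
  then show thesis using that u v pu pv by metis
qed

section \<open>The cone as a join of two planar cones\<close>

lemma Hilb_eq_if_diff_in:
  assumes "n \<in> Hilb \<sigma>" "g \<in> \<sigma>" "g \<in> int_lattice" "g \<noteq> 0" "n - g \<in> \<sigma>"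
  shows "n = g"
proof -
  have "n - g \<in> int_lattice" using assms unfolding Hilb_def int_lattice_def by auto
  moreover have "n = g + (n - g)" by simp
  ultimately have "n - g = 0" using assms unfolding Hilb_def by blast
  then show ?thesis by simp
qed

lemma vector_4_nth [simp]:
  "(vector [w, x, y, z] :: 'a::zero^4) $ 1 = w" "(vector [w, x, y, z] :: 'a::zero^4) $ 2 = x"
  "(vector [w, x, y, z] :: 'a::zero^4) $ 3 = y" "(vector [w, x, y, z] :: 'a::zero^4) $ 4 = z"
  unfolding vector_def by simp_all

locale join_cone =
  fixes a r :: int
  assumes coprime: "coprime a r" and a: "1 < a" "a < r - a"
begin

definition ht1 :: "real^4 \<Rightarrow> real" where "ht1 x = x $ 1"
definition pos1 :: "real^4 \<Rightarrow> real" where "pos1 x = x $ 4"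
definition ht2 :: "real^4 \<Rightarrow> real" where "ht2 x = x $ 2 + x $ 3 - x $ 4"
definition pos2 :: "real^4 \<Rightarrow> real" where "pos2 x = of_int r * x $ 3 - of_int (r - a) * x $ 4"

lemmas coord_defs = ht1_def pos1_def ht2_def pos2_def

text \<open>
  The lattice point with heights \<open>c\<close>, \<open>d\<close> and positions \<open>t\<close>, \<open>a * t + r * k\<close>. The four generators of the
  cone are \<open>e\<^sub>1 = pt 1 0 0 0\<close>, \<open>e\<^sub>2 = pt 0 1 0 0\<close>, \<open>e\<^sub>3 = pt 0 1 0 1\<close> and \<open>e\<^sub>4 = pt 1 0 r (- a)\<close>.
\<close>

definition pt :: "int \<Rightarrow> int \<Rightarrow> int \<Rightarrow> int \<Rightarrow> real^4" where
  "pt c d t k = vector [of_int c, of_int (d - k), of_int (t + k), of_int t]"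

definition join :: "(real^4) set" where
  "join = convex_cone hull {pt 1 0 0 0, pt 0 1 0 0, pt 0 1 0 1, pt 1 0 r (- a)}"

lemma linear_coord: "linear ht1" "linear pos1" "linear ht2" "linear pos2"
  by (rule linearI; simp add: coord_defs algebra_simps)+

lemma coord_arith:
  "ht1 (x + y) = ht1 x + ht1 y" "ht1 (x - y) = ht1 x - ht1 y" "ht1 (c *\<^sub>R x) = c * ht1 x"
  "pos1 (x + y) = pos1 x + pos1 y" "pos1 (x - y) = pos1 x - pos1 y" "pos1 (c *\<^sub>R x) = c * pos1 x"
  "ht2 (x + y) = ht2 x + ht2 y" "ht2 (x - y) = ht2 x - ht2 y" "ht2 (c *\<^sub>R x) = c * ht2 x"
  "pos2 (x + y) = pos2 x + pos2 y" "pos2 (x - y) = pos2 x - pos2 y" "pos2 (c *\<^sub>R x) = c * pos2 x"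
  by (simp_all add: linear_add linear_diff linear_scale linear_coord)

lemma coord_pt:
  "ht1 (pt c d t k) = of_int c" "pos1 (pt c d t k) = of_int t"
  "ht2 (pt c d t k) = of_int d" "pos2 (pt c d t k) = of_int (a * t + r * k)"
  by (simp_all add: coord_defs pt_def algebra_simps)

lemma r_pos: "0 < r" using a by simp

lemma coord_eqI:
  assumes "ht1 x = ht1 y" "pos1 x = pos1 y" "ht2 x = ht2 y" "pos2 x = pos2 y"
  shows "x = y"
  using assms r_pos by (auto simp: coord_defs vec_eq_iff forall_4)

lemma pt_lattice: "pt c d t k \<in> int_lattice"
  by (simp add: int_lattice_def pt_def forall_4)

lemma lattice_pt:
  assumes "x \<in> int_lattice" obtains c d t k where "x = pt c d t k"
proof -
  have "x $ 1 \<in> \<int>" "x $ 2 \<in> \<int>" "x $ 3 \<in> \<int>" "x $ 4 \<in> \<int>"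
    using assms by (auto simp: int_lattice_def)
  then obtain i1 i2 i3 i4 :: int where "x $ 1 = i1" "x $ 2 = i2" "x $ 3 = i3" "x $ 4 = i4"
    by (auto elim!: Ints_cases)
  then have "x = pt i1 (i2 + (i3 - i4)) i4 (i3 - i4)"
    by (simp add: pt_def vec_eq_iff forall_4)
  then show ?thesis by (rule that)
qed

lemma mem_join:
  "x \<in> join \<longleftrightarrow> 0 \<le> pos1 x \<and> pos1 x \<le> of_int r * ht1 x \<and> 0 \<le> pos2 x \<and> pos2 x \<le> of_int r * ht2 x"
  (is "_ \<longleftrightarrow> ?R")
proof
  assume x: "x \<in> join"
  have lin: "linear (\<lambda>x. \<alpha> * ht1 x + \<beta> * pos1 x + \<gamma> * ht2 x + \<delta> * pos2 x)" for \<alpha> \<beta> \<gamma> \<delta> :: real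
    by (rule linearI) (simp_all add: coord_arith algebra_simps)
  have "0 \<le> \<alpha> * ht1 x + \<beta> * pos1 x + \<gamma> * ht2 x + \<delta> * pos2 x"
    if "\<forall>g\<in>{pt 1 0 0 0, pt 0 1 0 0, pt 0 1 0 1, pt 1 0 r (- a)}.
      0 \<le> \<alpha> * ht1 g + \<beta> * pos1 g + \<gamma> * ht2 g + \<delta> * pos2 g" for \<alpha> \<beta> \<gamma> \<delta> :: real
    using linear_nonneg_on_hull[OF lin] that x unfolding join_def by blast
  from this[of 0 1 0 0] this[of "of_int r" "- 1" 0 0] this[of 0 0 0 1] this[of 0 0 "of_int r" "- 1"]
  show ?R using r_pos by (simp add: coord_pt)
next
  assume R: ?R
  define s where "s = pos1 x / r"
  define t where "t = pos2 x / r"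
  have bnd: "0 \<le> s" "s \<le> ht1 x" "0 \<le> t" "t \<le> ht2 x"
    using R r_pos by (auto simp: s_def t_def field_simps)
  have "x = (ht1 x - s) *\<^sub>R pt 1 0 0 0 + (ht2 x - t) *\<^sub>R pt 0 1 0 0 + t *\<^sub>R pt 0 1 0 1 + s *\<^sub>R pt 1 0 r (- a)"
    using r_pos by (intro coord_eqI) (simp_all add: coord_arith coord_pt s_def t_def)
  also have "\<dots> \<in> join"
    unfolding join_def using bnd
    by (intro convex_cone_hull_add convex_cone_hull_mul) (auto intro: hull_inc)
  finally show "x \<in> join" .
qed

text \<open>
  From every nonzero lattice point of the cone one of the listed points can be subtracted: \<open>e\<^sub>1\<close> if
  \<open>pos1 = 0 < ht1\<close>, \<open>e\<^sub>4\<close> if \<open>pos1 \<ge> r\<close>, and similarly \<open>e\<^sub>2\<close> or \<open>e\<^sub>3\<close> on the second side. A point with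
  height \<open>0\<close> on one side has a position divisible by \<open>r\<close> on the other, so it is covered. In the remaining
  case both heights are positive and both positions lie strictly between \<open>0\<close> and \<open>r\<close>, and the point with
  both heights \<open>1\<close> and the same positions can be subtracted.
\<close>

lemma Hilb_cases:
  assumes n: "n \<in> Hilb join"
  obtains "n = pt 1 0 0 0" | "n = pt 1 0 r (- a)" | "n = pt 0 1 0 0" | "n = pt 0 1 0 1"
    | t k where "n = pt 1 1 t k" "0 < t" "t < r" "0 < a * t + r * k" "a * t + r * k < r"
proof -
  have "n \<in> int_lattice" and n_in: "n \<in> join" and n0: "n \<noteq> 0" using n by (auto simp: Hilb_def)
  then obtain c d t k where npt: "n = pt c d t k" using lattice_pt by blast
  define s where "s = a * t + r * k"
  have "real_of_int 0 \<le> t" "real_of_int t \<le> r * c" "real_of_int 0 \<le> s" "real_of_int s \<le> r * d"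
    using n_in unfolding mem_join npt coord_pt s_def by auto
  then have ineq: "0 \<le> t" "t \<le> r * c" "0 \<le> s" "s \<le> r * d" by (metis of_int_le_iff of_int_mult)+
  have nn: "0 \<le> c" "0 \<le> d"
    using ineq r_pos by (meson order_trans zero_le_mult_iff not_less)+
  have step: "n = pt c' d' t' k'"
    if "0 \<le> t'" "t' \<le> r * c'" "0 \<le> a * t' + r * k'" "a * t' + r * k' \<le> r * d'" "(c', d') \<noteq> (0, 0)"
      "t' \<le> t" "t - t' \<le> r * (c - c')" "a * t' + r * k' \<le> s" "s - (a * t' + r * k') \<le> r * (d - d')" for c' d' t' k'
  proof (rule Hilb_eq_if_diff_in[OF n])
    have le: "real_of_int x \<le> real_of_int y" if "x \<le> y" for x y using that by simp
    show "pt c' d' t' k' \<in> join"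
      unfolding mem_join coord_pt using le[OF that(1)] le[OF that(2)] le[OF that(3)] le[OF that(4)] by simp
    show "n - pt c' d' t' k' \<in> join"
      unfolding mem_join coord_arith npt coord_pt s_def[symmetric]
      using le[OF that(6)] le[OF that(7)] le[OF that(8)] le[OF that(9)] by simp
    have "ht1 (pt c' d' t' k') \<noteq> 0 \<or> ht2 (pt c' d' t' k') \<noteq> 0" using that(5) by (auto simp: coord_pt)
    then show "pt c' d' t' k' \<noteq> 0" using linear_0[OF linear_coord(1)] linear_0[OF linear_coord(3)] by auto
  qed (rule pt_lattice)
  show thesis
  proof (cases "c = 0 \<or> d = 0 \<or> t = 0 \<or> s = 0 \<or> r \<le> t \<or> r \<le> s")
    case False
    have "1 \<le> c" "1 \<le> d" using False nn by auto
    then have "r * 1 \<le> r * c" "r * 1 \<le> r * d" using r_pos by (intro mult_left_mono; simp)+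
    have "0 \<le> r * (c - 1)" "0 \<le> r * (d - 1)" using \<open>1 \<le> c\<close> \<open>1 \<le> d\<close> r_pos by auto
    then have "n = pt 1 1 t k"
      using False ineq by (intro step) (auto simp: s_def)
    then show thesis using that(5) False ineq unfolding s_def by fastforce
  next
    case True
    consider "1 \<le> c" "t = 0" | "1 \<le> c" "r \<le> t" | "1 \<le> d" "s = 0" | "1 \<le> d" "r \<le> s"
    proof -
      have c0: "t = 0" "r dvd s" if "c = 0" using that ineq by (auto simp: s_def)
      have d0: "s = 0" "r dvd t" if "d = 0"
      proof -
        show "s = 0" using that ineq by auto
        then have "a * t = r * (- k)" by (simp add: s_def)
        then have "r dvd a * t" by (rule dvdI)
        then show "r dvd t" using coprime by (simp add: coprime_commute coprime_dvd_mult_right_iff)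
      qed
      have ge: "x = 0 \<or> r \<le> x" if "r dvd x" "0 \<le> x" for x
        using that zdvd_imp_le[of r x] by fastforce
      have "n = 0" if "c = 0" "d = 0"
        using that c0(1) d0(1) r_pos unfolding npt s_def
        by (intro coord_eqI) (auto simp: coord_pt linear_0[OF linear_coord(1)] linear_0[OF linear_coord(2)]
            linear_0[OF linear_coord(3)] linear_0[OF linear_coord(4)])
      then have "1 \<le> c \<or> 1 \<le> d" using n0 nn by linarith
      moreover have "s = 0 \<or> r \<le> s" if "c = 0" using ge c0 that ineq by blast
      moreover have "t = 0 \<or> r \<le> t" if "d = 0" using ge d0 that ineq by blast
      ultimately show thesis using that True nn by (smt (verit))
    qed
    then show thesis
    proof cases
      case 1
      then have "0 \<le> r * (c - 1)" using r_pos by auto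
      then have "n = pt 1 0 0 0" using 1 ineq r_pos by (intro step) auto
      then show thesis by (rule that(1))
    next
      case 2
      then have "n = pt 1 0 r (- a)" using ineq r_pos by (intro step) (auto simp: algebra_simps)
      then show thesis by (rule that(2))
    next
      case 3
      then have "0 \<le> r * (d - 1)" using r_pos by auto
      then have "n = pt 0 1 0 0" using 3 ineq r_pos by (intro step) auto
      then show thesis by (rule that(3))
    next
      case 4
      then have "n = pt 0 1 0 1" using ineq r_pos by (intro step) (auto simp: algebra_simps)
      then show thesis by (rule that(4))
    qed
  qed
qed

lemma inverse_mod_r: obtains b where "r dvd a * b - 1"
proof -
  obtain u v where "u * a + v * r = 1" using bezout_int[of a r] coprime by auto
  then have "a * u - 1 = r * (- v)" by (simp add: algebra_simps)
  then have "r dvd a * u - 1" by (rule dvdI)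
  then show ?thesis by (rule that)
qed

text \<open>
  In the quotient by \<open>e\<^sub>1\<close> and \<open>e\<^sub>4\<close>, a vector with \<open>ht2 = 0\<close> and \<open>pos2 = 1\<close> is the image of a lattice
  point, because \<open>a\<close> is invertible modulo \<open>r\<close>. Evaluating there shows that the coefficient of \<open>pos2\<close> is
  integral.
\<close>

lemma functional_through_side2:
  assumes "linear \<phi>" "\<phi> (pt 1 0 0 0) = 0" "\<phi> (pt 1 0 r (- a)) = 0" "\<And>x. x \<in> int_lattice \<Longrightarrow> \<phi> x \<in> \<int>"
  shows "\<exists>\<alpha> \<beta>. \<beta> \<in> \<int> \<and> (\<forall>x. \<phi> x = \<alpha> * ht2 x + \<beta> * pos2 x)"
proof -
  define \<alpha> where "\<alpha> = \<phi> (pt 0 1 0 0)"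
  define \<beta> where "\<beta> = (\<phi> (pt 0 1 0 1) - \<alpha>) / r"
  have eq: "\<phi> x = \<alpha> * ht2 x + \<beta> * pos2 x" for x
  proof -
    define s where "s = pos1 x / r"
    define t where "t = pos2 x / r"
    have "x = (ht1 x - s) *\<^sub>R pt 1 0 0 0 + (ht2 x - t) *\<^sub>R pt 0 1 0 0 + t *\<^sub>R pt 0 1 0 1 + s *\<^sub>R pt 1 0 r (- a)"
      using r_pos by (intro coord_eqI) (simp_all add: coord_arith coord_pt s_def t_def)
    from arg_cong[OF this, of \<phi>]
    have "\<phi> x = (ht2 x - t) * \<phi> (pt 0 1 0 0) + t * \<phi> (pt 0 1 0 1)"
      by (simp add: assms(2,3) linear_add[OF assms(1)] linear_scale[OF assms(1)])
    then show ?thesis using r_pos by (simp add: \<alpha>_def \<beta>_def t_def field_simps)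
  qed
  obtain b k where b: "a * b - 1 = r * k" using inverse_mod_r unfolding dvd_def by metis
  have "\<phi> (pt 0 0 b (- k)) = \<beta> * of_int (a * b - r * k)"
    unfolding eq by (simp add: coord_pt)
  moreover have "a * b - r * k = 1" using b by simp
  ultimately have "\<phi> (pt 0 0 b (- k)) = \<beta>" by simp
  then have "\<beta> \<in> \<int>" using assms(4)[OF pt_lattice] by metis
  then show ?thesis using eq by blast
qed

text \<open>The corresponding lattice point for the quotient by \<open>e\<^sub>2\<close> and \<open>e\<^sub>3\<close> is \<open>pt 0 0 1 0\<close>.\<close>

lemma functional_through_side1:
  assumes "linear \<phi>" "\<phi> (pt 0 1 0 0) = 0" "\<phi> (pt 0 1 0 1) = 0" "\<And>x. x \<in> int_lattice \<Longrightarrow> \<phi> x \<in> \<int>"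
  shows "\<exists>\<alpha> \<beta>. \<beta> \<in> \<int> \<and> (\<forall>x. \<phi> x = \<alpha> * ht1 x + \<beta> * pos1 x)"
proof -
  have "\<phi> x = \<phi> (pt 1 0 0 0) * ht1 x + \<phi> (pt 0 0 1 0) * pos1 x" for x
  proof -
    define t where "t = (pos2 x - a * pos1 x) / r"
    have "x = ht1 x *\<^sub>R pt 1 0 0 0 + pos1 x *\<^sub>R pt 0 0 1 0 + (ht2 x - t) *\<^sub>R pt 0 1 0 0 + t *\<^sub>R pt 0 1 0 1"
      using r_pos by (intro coord_eqI) (simp_all add: coord_arith coord_pt t_def)
    from arg_cong[OF this, of \<phi>]
    have "\<phi> x = ht1 x * \<phi> (pt 1 0 0 0) + pos1 x * \<phi> (pt 0 0 1 0)"
      by (simp add: assms(2,3) linear_add[OF assms(1)] linear_scale[OF assms(1)])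
    then show ?thesis by simp
  qed
  then show ?thesis using assms(4)[OF pt_lattice] by blast
qed

lemma mult_r_eq_if_close:
  assumes "0 < x + r * k" "x + r * k < r" "0 < x + r * k'" "x + r * k' < r"
  shows "k = k'"
proof -
  have "\<bar>r * (k - k')\<bar> < r" using assms by (simp add: algebra_simps abs_less_iff)
  then have "r * \<bar>k - k'\<bar> < r * 1" using r_pos by (simp add: abs_mult)
  then have "\<bar>k - k'\<bar> < 1" using r_pos by (simp only: mult_less_cancel_left_pos)
  then show ?thesis by simp
qed

lemma Hilb_eq_by_pos1:
  assumes u: "u \<in> Hilb join" "ht1 u = 1" "pos1 u = of_int t" and t: "0 < t" "t < r"
    and k: "0 < a * t + r * k" "a * t + r * k < r"
  shows "u = pt 1 1 t k"
  using u(1)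
proof (cases rule: Hilb_cases)
  case (5 t' k')
  then have "t' = t" using u by (simp add: coord_pt)
  moreover have "k' = k" using mult_r_eq_if_close[of "a * t"] 5 k \<open>t' = t\<close> by blast
  ultimately show ?thesis using 5 by simp
qed (use u t in \<open>auto simp: coord_pt\<close>)

lemma cancel_a_mod_r:
  assumes "r dvd a * (t - t')" "0 \<le> t" "t < r" "0 \<le> t'" "t' < r"
  shows "t = t'"
proof -
  have "r dvd t - t'" using assms(1) coprime by (simp add: coprime_commute coprime_dvd_mult_right_iff)
  then have "t mod r = t' mod r" by (simp add: mod_eq_dvd_iff)
  then show ?thesis using assms by simp
qed

lemma Hilb_eq_by_pos2:
  assumes u: "u \<in> Hilb join" "ht2 u = 1" "pos2 u = of_int s" and s: "0 < s" "s < r" "s = a * t + r * k"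
    and t: "0 < t" "t < r"
  shows "u = pt 1 1 t k"
  using u(1)
proof (cases rule: Hilb_cases)
  case (5 t' k')
  have "real_of_int (a * t' + r * k') = of_int s" using u 5 by (simp only: coord_pt)
  then have eq: "a * t' + r * k' = a * t + r * k" using s(3) by (simp only: of_int_eq_iff)
  then have "a * (t - t') = r * (k' - k)" by (simp add: algebra_simps)
  then have "t = t'" using cancel_a_mod_r[of t t'] t 5 by simp
  then show ?thesis using eq 5 r_pos by auto
qed (use u(2,3) s(1,2) in \<open>auto simp: coord_pt\<close>)

section \<open>Cones of a Hilbert basis resolution\<close>

lemma resolution_generators:
  assumes R: "Hilbert_basis_resolution \<Sigma> join" and x: "x \<in> join"
  obtains \<tau> G B where "\<tau> \<in> \<Sigma>" "\<tau> = convex_cone hull G" "x \<in> convex_cone hull G" "G \<subseteq> Hilb join"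
    "lattice_basis B" "G \<subseteq> B"
proof -
  obtain \<tau> where \<tau>: "\<tau> \<in> \<Sigma>" "x \<in> \<tau>"
    using R x unfolding Hilbert_basis_resolution_def subdivision_def by auto
  have "toric_cone \<tau>" using R \<tau> unfolding Hilbert_basis_resolution_def subdivision_def fan_def by blast
  then obtain G where G: "G \<subseteq> Gen \<tau>" "\<tau> = convex_cone hull G" by (rule toric_cone_generated_by_Gen)
  obtain B where "lattice_basis B" "Gen \<tau> \<subseteq> B"
    using R \<tau> unfolding Hilbert_basis_resolution_def smooth_fan_def smooth_cone_def by blast
  moreover have "Gen \<tau> \<subseteq> Hilb join"
    using R \<tau> unfolding Hilbert_basis_resolution_def fan_Gen_def by blast
  ultimately show ?thesis using that \<tau> G by blast
qed

text \<open>
  The last conclusion holds because the generators of \<open>\<tau>\<close> other than \<open>e\<^sub>1\<close> and \<open>e\<^sub>4\<close> have height \<open>1\<close> and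
  position \<open>l\<close> or \<open>l + 1\<close>. It is what a crossing contradicts: a Hilbert basis element of height \<open>1\<close> at any
  other level is outside \<open>\<tau>\<close>.
\<close>

lemma section_of_side1:
  assumes R: "Hilbert_basis_resolution \<Sigma> join"
    and x: "x \<in> join" "ht2 x = 2" "pos2 x = 2 * of_int l + 1" "2 * r < pos1 x" "2 * r < r * ht1 x - pos1 x"
  obtains \<tau> u v where "\<tau> \<in> \<Sigma>" "u \<in> \<tau> \<inter> Hilb join" "v \<in> \<tau> \<inter> Hilb join" "ht2 u = 1" "ht2 v = 1"
    "pos2 u = of_int l" "pos2 v = of_int l + 1"
    "\<And>y. y \<in> \<tau> \<Longrightarrow> of_int l * ht2 y \<le> pos2 y \<and> pos2 y \<le> (of_int l + 1) * ht2 y"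
proof -
  obtain \<tau> G B where \<tau>: "\<tau> \<in> \<Sigma>" "\<tau> = convex_cone hull G" "x \<in> convex_cone hull G" "G \<subseteq> Hilb join"
    "lattice_basis B" "G \<subseteq> B" using resolution_generators[OF R x(1)] .
  have gens: "g = pt 1 0 0 0 \<or> g = pt 1 0 r (- a) \<or>
    ht2 g = 1 \<and> pos2 g \<in> \<int> \<and> pos1 g \<le> r \<and> r * ht1 g - pos1 g \<le> r" if "g \<in> G" for g
    using subsetD[OF \<tau>(4) that] by (cases rule: Hilb_cases) (use r_pos in \<open>auto simp: coord_pt\<close>)
  have adj: "\<bar>pos2 u - pos2 v\<bar> = 1"
    if "pt 1 0 0 0 \<in> G" "pt 1 0 r (- a) \<in> G" "u \<in> G" "v \<in> G" "u \<noteq> v" "ht2 u = 1" "ht2 v = 1" for u v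
  proof (rule unimodular_adjacent[OF \<tau>(5) _ _ _ _ that(5) _ _ functional_through_side2])
    show "pos2 u \<in> \<int>" "pos2 v \<in> \<int>" using gens[OF that(3)] gens[OF that(4)] that(6,7) by (auto simp: coord_pt)
  qed (use that \<tau>(6) in \<open>auto simp: coord_pt\<close>)
  obtain u v where "u \<in> G" "v \<in> G" "ht2 u = 1" "ht2 v = 1" "pos2 u = of_int l" "pos2 v = of_int l + 1"
    "\<And>y. y \<in> convex_cone hull G \<Longrightarrow> of_int l * ht2 y \<le> pos2 y \<and> pos2 y \<le> (of_int l + 1) * ht2 y"
    by (rule consecutive_sections[OF linear_coord, of r "pt 1 0 0 0" "pt 1 0 r (- a)" G x l])
      (use r_pos gens adj x \<tau>(3) in \<open>simp_all add: coord_pt\<close>)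
  then show thesis using that[OF \<tau>(1), of u v] \<tau>(2,4) hull_inc[of _ G] by blast
qed

lemma section_of_side2:
  assumes R: "Hilbert_basis_resolution \<Sigma> join"
    and x: "x \<in> join" "ht1 x = 2" "pos1 x = 2 * of_int l + 1" "2 * r < pos2 x" "2 * r < r * ht2 x - pos2 x"
  obtains \<tau> u v where "\<tau> \<in> \<Sigma>" "u \<in> \<tau> \<inter> Hilb join" "v \<in> \<tau> \<inter> Hilb join" "ht1 u = 1" "ht1 v = 1"
    "pos1 u = of_int l" "pos1 v = of_int l + 1"
proof -
  obtain \<tau> G B where \<tau>: "\<tau> \<in> \<Sigma>" "\<tau> = convex_cone hull G" "x \<in> convex_cone hull G" "G \<subseteq> Hilb join"
    "lattice_basis B" "G \<subseteq> B" using resolution_generators[OF R x(1)] .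
  have gens: "g = pt 0 1 0 0 \<or> g = pt 0 1 0 1 \<or>
    ht1 g = 1 \<and> pos1 g \<in> \<int> \<and> pos2 g \<le> r \<and> r * ht2 g - pos2 g \<le> r" if "g \<in> G" for g
    using subsetD[OF \<tau>(4) that]
    by (cases rule: Hilb_cases) (use r_pos in \<open>auto simp: coord_pt simp flip: of_int_mult of_int_add\<close>)
  have adj: "\<bar>pos1 u - pos1 v\<bar> = 1"
    if "pt 0 1 0 0 \<in> G" "pt 0 1 0 1 \<in> G" "u \<in> G" "v \<in> G" "u \<noteq> v" "ht1 u = 1" "ht1 v = 1" for u v
  proof (rule unimodular_adjacent[OF \<tau>(5) _ _ _ _ that(5) _ _ functional_through_side1])
    show "pos1 u \<in> \<int>" "pos1 v \<in> \<int>" using gens[OF that(3)] gens[OF that(4)] that(6,7) by (auto simp: coord_pt)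
  qed (use that \<tau>(6) in \<open>auto simp: coord_pt\<close>)
  obtain u v where "u \<in> G" "v \<in> G" "ht1 u = 1" "ht1 v = 1" "pos1 u = of_int l" "pos1 v = of_int l + 1"
    by (rule consecutive_sections[OF linear_coord(3,4,1,2), of r "pt 0 1 0 0" "pt 0 1 0 1" G x l])
      (use r_pos gens adj x \<tau>(3) in \<open>simp_all add: coord_pt\<close>)
  then show thesis using that[OF \<tau>(1), of u v] \<tau>(2,4) hull_inc[of _ G] by blast
qed

text \<open>
  The intersection of two cones of a fan is cut out of either of them by a supporting hyperplane; if this
  hyperplane contains a positive combination of \<open>p\<close> and \<open>p'\<close>, then it contains \<open>p\<close>.
\<close>

lemma fan_cone_contains_segment:
  assumes "fan \<Sigma>" "\<tau>1 \<in> \<Sigma>" "\<tau>2 \<in> \<Sigma>" "p \<in> \<tau>1" "p' \<in> \<tau>1" "0 < \<gamma>" "0 < \<delta>" "\<gamma> *\<^sub>R p + \<delta> *\<^sub>R p' \<in> \<tau>1 \<inter> \<tau>2"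
  shows "p \<in> \<tau>2"
proof -
  have "cone_face (\<tau>1 \<inter> \<tau>2) \<tau>1" "toric_cone \<tau>1" using assms unfolding fan_def by auto
  then obtain w where w: "\<forall>x\<in>\<tau>1. 0 \<le> w \<bullet> x" "\<tau>1 \<inter> \<tau>2 = \<tau>1 \<inter> {x. w \<bullet> x = 0}"
    using cone_face_iff_supporting by blast
  then have "\<gamma> * (w \<bullet> p) + \<delta> * (w \<bullet> p') = 0"
    using assms(8) by (auto simp: inner_right_distrib)
  moreover have "0 \<le> \<gamma> * (w \<bullet> p)" "0 \<le> \<delta> * (w \<bullet> p')" using w assms by auto
  ultimately have "w \<bullet> p = 0" using assms(6) by (simp add: add_nonneg_eq_0_iff)
  then show ?thesis using w assms(4) by blast
qed

lemma int_change:
  fixes i j :: int and P :: "int \<Rightarrow> bool"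
  assumes "i \<le> j" "P i \<noteq> P j"
  obtains l where "i \<le> l" "l < j" "P l \<noteq> P (l + 1)"
proof -
  have "P n = P i" if "i \<le> n" "n \<le> j" "\<And>l. i \<le> l \<Longrightarrow> l < j \<Longrightarrow> P l = P (l + 1)" for n
    using that(1,2) by (induction n rule: int_ge_induct) (use that(3) in auto)
  then show ?thesis using assms that by blast
qed

section \<open>The crossing\<close>

lemma no_Hilbert_basis_resolution: "\<not> Hilbert_basis_resolution \<Sigma> join"
proof
  assume R: "Hilbert_basis_resolution \<Sigma> join"
  define m where "m = r div a"
  have "a * m + r mod a = r" by (simp add: m_def)
  moreover have "0 \<le> r mod a" "r mod a < a" using a by auto
  moreover have "a * (m + 1) = a * m + a" by (simp add: algebra_simps)
  ultimately have "a * m \<le> r" "r < a * (m + 1)" by linarith+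
  moreover have "a * m \<noteq> r"
  proof
    assume "a * m = r"
    then have "a dvd r" by auto
    then have "is_unit a" using coprime coprime_absorb_left by blast
    then show False using a by simp
  qed
  ultimately have am: "a * m < r" "r < a * (m + 1)" by auto
  have m2: "2 \<le> m"
  proof (rule ccontr)
    assume "\<not> 2 \<le> m"
    then have "a * (m + 1) \<le> a * 2" using a by (intro mult_left_mono) auto
    then show False using am a by linarith
  qed
  have "2 * m \<le> a * m" using a m2 by (intro mult_right_mono) auto
  then have mr: "m + 2 < r" using am m2 by linarith
  have am2: "2 * a \<le> a * m" using mult_left_mono[OF m2, of a] a by linarith
  obtain b where b: "r dvd a * b - 1" using inverse_mod_r .
  \<comment> \<open>The Hilbert basis element at level \<open>pos2 = l\<close> is \<open>pt 1 1 (t l) (k l)\<close>.\<close>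
  define t where "t l = (b * l) mod r" for l
  define k where "k l = (l - a * t l) div r" for l
  have tr: "0 \<le> t l" "t l < r" for l using r_pos by (auto simp: t_def)
  have tk: "a * t l + r * k l = l" for l
  proof -
    have "a * t l - l = (a * b - 1) * l - r * (a * (b * l div r))"
      by (simp add: t_def minus_mult_div_eq_mod[symmetric] algebra_simps)
    then have "r dvd a * t l - l" using b by simp
    then have "r dvd l - a * t l" by (simp add: dvd_diff_commute)
    then show ?thesis unfolding k_def by simp
  qed
  have t_eq: "t l = s" if "0 \<le> s" "s < r" "a * s + r * j = l" for l s j
  proof (rule cancel_a_mod_r)
    have "a * (t l - s) = r * (j - k l)" using tk[of l] that(3) by (simp add: algebra_simps)
    then show "r dvd a * (t l - s)" by simp
  qed (use tr that in auto)
  have tpos: "0 < t l" if "0 < l" "l < r" for l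
  proof (rule ccontr)
    assume "\<not> 0 < t l"
    then have "t l = 0" using tr[of l] by simp
    then have "r dvd l" using tk[of l] by (metis add_0 dvd_triv_left mult_zero_right)
    then show False using that zdvd_not_zless by blast
  qed
  have ta: "t a = 1" using t_eq[of 1 0 a] a by simp
  have tm2: "t (a * (m + 2) - r) = m + 2" using t_eq[of "m + 2" "- 1"] mr m2 by simp
  \<comment> \<open>\<open>h\<^sub>1\<close> and \<open>h\<^bsub>m+2\<^esub>\<close> lie on different sides of the long segment, at levels \<open>a\<close> and \<open>a (m + 2) - r\<close>.\<close>
  have change: "(t a \<le> m) \<noteq> (t (a * (m + 2) - r) \<le> m)" unfolding ta tm2 using m2 by simp
  obtain l where l: "a * (m + 1) - r < l" "l + 1 < a * m" "(t l \<le> m) \<noteq> (t (l + 1) \<le> m)"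
  proof (cases "a \<le> a * (m + 2) - r")
    case True
    obtain l where l: "a \<le> l" "l < a * (m + 2) - r" "(t l \<le> m) \<noteq> (t (l + 1) \<le> m)"
      using int_change[OF True, of "\<lambda>l. t l \<le> m"] change by blast
    have "a * (m + 1) - r < l" "l + 1 < a * m" using l(1,2) am a by (simp_all add: algebra_simps)
    then show ?thesis using that l(3) by blast
  next
    case False
    then have "a * (m + 2) - r \<le> a" by simp
    then obtain l where l: "a * (m + 2) - r \<le> l" "l < a" "(t l \<le> m) \<noteq> (t (l + 1) \<le> m)"
      using int_change[of "a * (m + 2) - r" a "\<lambda>l. t l \<le> m"] change by blast
    have "a * (m + 1) - r < l" "l + 1 < a * m" using l(1,2) am am2 a by (simp_all add: algebra_simps)
    then show ?thesis using that l(3) by blast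
  qed
  have l0: "0 < l" "l + 1 < r" using l(1,2) am by linarith+

  \<comment> \<open>Adding \<open>2 (e\<^sub>1 + e\<^sub>4)\<close> moves the point far enough out for \<open>section_of_side1\<close>.\<close>
  let ?x = "2 *\<^sub>R (pt 1 0 0 0 + pt 1 0 r (- a)) + pt 1 1 (t l) (k l) + pt 1 1 (t (l + 1)) (k (l + 1))"
  have bnd: "0 < real_of_int (t l)" "real_of_int (t l) < r" "0 < real_of_int (t (l + 1))" "real_of_int (t (l + 1)) < r"
    "0 < real_of_int l" "real_of_int l + 1 < r"
    using tpos[of l] tpos[of "l + 1"] tr[of l] tr[of "l + 1"] l0 by auto
  have xc: "ht1 ?x = 6" "ht2 ?x = 2" "pos1 ?x = 2 * r + t l + t (l + 1)" "pos2 ?x = 2 * l + 1"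
    unfolding coord_arith coord_pt tk by simp_all
  obtain \<tau>2 u v where \<tau>2: "\<tau>2 \<in> \<Sigma>" "u \<in> \<tau>2 \<inter> Hilb join" "v \<in> \<tau>2 \<inter> Hilb join" "ht2 u = 1" "ht2 v = 1"
    "pos2 u = of_int l" "pos2 v = of_int l + 1"
    and sec: "\<And>y. y \<in> \<tau>2 \<Longrightarrow> of_int l * ht2 y \<le> pos2 y \<and> pos2 y \<le> (of_int l + 1) * ht2 y"
    by (rule section_of_side1[OF R, of ?x l]) (use bnd in \<open>simp_all add: mem_join xc\<close>)
  have u: "u = pt 1 1 (t l) (k l)"
    using \<tau>2 l0 tpos[of l] tr[of l] tk[of l] by (intro Hilb_eq_by_pos2[of _ l]) auto
  have v: "v = pt 1 1 (t (l + 1)) (k (l + 1))"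
    using \<tau>2 l0 tpos[of "l + 1"] tr[of "l + 1"] tk[of "l + 1"] by (intro Hilb_eq_by_pos2[of _ "l + 1"]) auto

  let ?x = "2 *\<^sub>R (pt 0 1 0 0 + pt 0 1 0 1) + pt 1 1 m 0 + pt 1 1 (m + 1) (- 1)"
  have ineq: "a * (m + 1) + r * (- 1) < r" "0 < a * (m + 1) + r * (- 1)" "0 < a * m" "0 < m" "m + 1 < r"
    using am a m2 mr by (auto simp: algebra_simps)
  have bnd: "0 < real_of_int (a * m)" "real_of_int (a * m) < r" "0 < real_of_int (a * (m + 1) + r * (- 1))"
    "real_of_int (a * (m + 1) + r * (- 1)) < r" "0 < real_of_int m" "real_of_int m + 1 < r"
    using ineq am by linarith+
  have xc: "ht1 ?x = 2" "ht2 ?x = 6" "pos1 ?x = 2 * m + 1"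
    "pos2 ?x = 2 * r + of_int (a * m) + of_int (a * (m + 1) + r * (- 1))"
    unfolding coord_arith coord_pt by simp_all
  obtain \<tau>1 p p' where \<tau>1: "\<tau>1 \<in> \<Sigma>" "p \<in> \<tau>1 \<inter> Hilb join" "p' \<in> \<tau>1 \<inter> Hilb join" "ht1 p = 1" "ht1 p' = 1"
    "pos1 p = of_int m" "pos1 p' = of_int m + 1"
    by (rule section_of_side2[OF R, of ?x m])
      (use bnd in \<open>simp_all add: mem_join xc del: of_int_mult of_int_add of_int_diff\<close>)
  have p: "p = pt 1 1 m 0" using \<tau>1 ineq am by (intro Hilb_eq_by_pos1) auto
  have p': "p' = pt 1 1 (m + 1) (- 1)" using \<tau>1 ineq am by (intro Hilb_eq_by_pos1) auto

  \<comment> \<open>The sign of \<open>side\<close> tells on which side of the line through \<open>p\<close> and \<open>p'\<close> the element at level \<open>l\<close> lies.\<close>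
  define \<delta> where "\<delta> = r - a"
  define side where "side l = \<delta> * (t l - m) + (l - a * m)" for l
  have \<delta>: "0 < \<delta>" using a by (simp add: \<delta>_def)
  have neg: "side i < 0" if "t i \<le> m" "i < a * m" for i
  proof -
    have "\<delta> * (t i - m) \<le> 0" using \<delta> that by (simp add: mult_nonneg_nonpos)
    then show ?thesis using that by (simp add: side_def)
  qed
  have pos: "0 < side i" if "\<not> t i \<le> m" "a * (m + 1) - r < i" for i
  proof -
    have "\<delta> * 1 \<le> \<delta> * (t i - m)" using \<delta> that by (intro mult_left_mono) auto
    then show ?thesis using that by (simp add: side_def \<delta>_def algebra_simps)
  qed
  obtain \<alpha> \<beta> where \<alpha>\<beta>: "0 < \<alpha>" "0 < \<beta>" "\<alpha> * side l + \<beta> * side (l + 1) = 0"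
  proof (cases "t l \<le> m")
    case True
    then show ?thesis
      using that[of "side (l + 1)" "- side l"] neg[of l] pos[of "l + 1"] l by simp
  next
    case False
    then show ?thesis
      using that[of "- side (l + 1)" "side l"] pos[of l] neg[of "l + 1"] l by simp
  qed
  \<comment> \<open>Coefficients of the crossing point \<open>\<delta> (\<alpha> u + \<beta> v) = \<gamma> p + \<eta> p'\<close>: \<open>\<eta>\<close> measures how far it is below
    the level of \<open>p\<close>, and \<open>\<gamma>\<close> how far it is above the level of \<open>p'\<close>.\<close>
  define \<eta> where "\<eta> = (\<alpha> + \<beta>) * (a * m) - (\<alpha> * l + \<beta> * (l + 1))"
  define \<gamma> where "\<gamma> = (\<alpha> + \<beta>) * \<delta> - \<eta>"
  have "0 < \<alpha> * (a * m - l)" "0 < \<beta> * (a * m - (l + 1))"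
    "0 < \<alpha> * (l - (a * m - \<delta>))" "0 < \<beta> * (l + 1 - (a * m - \<delta>))"
    using \<alpha>\<beta>(1,2) l(1,2) by (intro mult_pos_pos; simp add: \<delta>_def algebra_simps)+
  then have pos\<eta>: "0 < \<eta>" "0 < \<gamma>" by (simp_all add: \<eta>_def \<gamma>_def algebra_simps)
  have "\<delta> * (\<alpha> * t l + \<beta> * t (l + 1)) = \<gamma> * m + \<eta> * (m + 1)"
    using \<alpha>\<beta>(3) by (simp add: side_def \<eta>_def \<gamma>_def algebra_simps)
  from arg_cong[OF this, of real_of_int]
  have e1: "\<delta> * (\<alpha> * t l + \<beta> * t (l + 1)) = \<gamma> * real_of_int m + \<eta> * (m + 1)" by simp
  have "\<delta> * (\<alpha> * l + \<beta> * (l + 1)) = \<gamma> * (a * m) + \<eta> * (a * (m + 1) - r)"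
    by (simp add: \<eta>_def \<gamma>_def \<delta>_def algebra_simps)
  from arg_cong[OF this, of real_of_int]
  have e2: "\<delta> * (\<alpha> * l + \<beta> * (l + 1)) = \<gamma> * real_of_int (a * m) + \<eta> * (a * (m + 1) - r)" by simp
  have e3: "real_of_int \<delta> * (\<alpha> + \<beta>) = \<gamma> + \<eta>" by (simp add: \<gamma>_def)
  let ?y = "real_of_int \<delta> *\<^sub>R (real_of_int \<alpha> *\<^sub>R u + real_of_int \<beta> *\<^sub>R v)"
  have y: "?y = real_of_int \<gamma> *\<^sub>R p + real_of_int \<eta> *\<^sub>R p'"
    unfolding u v p p'
    by (rule coord_eqI; unfold coord_arith coord_pt tk) (use e1 e2 e3 in \<open>simp_all add: algebra_simps\<close>)
  have fan: "fan \<Sigma>" using R unfolding Hilbert_basis_resolution_def subdivision_def by blast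
  have cone: "\<exists>S. \<tau> = convex_cone hull S" if "\<tau> \<in> \<Sigma>" for \<tau>
    using fan that unfolding fan_def toric_cone_def by blast
  have "?y \<in> \<tau>2"
    using cone[OF \<tau>2(1)] \<tau>2(2,3) \<alpha>\<beta> \<delta> by (auto intro!: convex_cone_hull_add convex_cone_hull_mul)
  moreover have "?y \<in> \<tau>1"
    unfolding y using cone[OF \<tau>1(1)] \<tau>1(2,3) pos\<eta> by (auto intro!: convex_cone_hull_add convex_cone_hull_mul)
  ultimately have "p \<in> \<tau>2"
    using fan_cone_contains_segment[OF fan \<tau>1(1) \<tau>2(1), of p p' \<gamma> \<eta>] \<tau>1(2,3) pos\<eta> y by simp
  from sec[OF this] have "real_of_int (a * m) \<le> l + 1" unfolding p coord_pt by simp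
  then show False using l(2) by linarith
qed

end

theorem theorem3p12:
  fixes a r :: int and \<sigma> :: "(real^4) set"
  assumes "gcd a r = 1"
    and "1 < a" and "a < r - a" and "r - a < r" and "\<not> 2 dvd r"
    and "\<sigma> = convex_cone hull
          {vector [1, 0, 0, 0], vector [0, 1, 0, 0], vector [0, 0, 1, 0],
           vector [1, of_int a, of_int (r - a), of_int r]}"
  shows "\<not> (\<exists>\<Sigma>. Hilbert_basis_resolution \<Sigma> \<sigma>)"
proof -
  interpret join_cone a r
    using assms by unfold_locales (simp_all add: coprime_iff_gcd_eq_1)
  have "\<sigma> = join"
    unfolding assms(6) join_def by (simp add: pt_def insert_commute)
  then show ?thesis using no_Hilbert_basis_resolution by simp
qed

end
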